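(* Let $\mathbf{f} = (f_1,\dots,f_n) \in \mathbb{R}[\mathbf{x}]^n$ with $\mathbf{f}(\mathbf{0}) = \mathbf{0}$, let $p_1, p_2 \in \mathbb{R}[\mathbf{x}]$ be strictly positive on $\mathbb{R}^n \setminus \{\mathbf{0}\}$, and let $A = A^+ \cup A^- \subset \mathbb{N}^n$ be a finite support set with fixed sign distribution. The problem of finding a polynomial $V$ with $$V(\mathbf{0}) = 0, \qquad V - p_1 \in \mathcal{D}_{A^+,A^-}, \qquad -\dot V \in \mathcal{D}_{A^+,A^-}$$ (and, for the asymptotic stability version, additionally $-\dot V - p_2 \in \mathcal{D}_{A^+,A^-}$) can be stated as a relative entropy program (REP). That is, there is an REP whose variables are the coefficients of $V$ together with finitely many additional variables, such that $V$ satisfies the conditions if and only if its coefficient vector extends to a feasible point of the REP.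
   Context: For a polynomial $V$, $\dot V(\mathbf{x}) = \sum_{i=1}^n \frac{\partial V}{\partial x_i}(\mathbf{x}) f_i(\mathbf{x})$ is the derivative of $V$ along the system $\dot{\mathbf{x}} = \mathbf{f}(\mathbf{x})$. Note that the conditions force $V$ to have support in the finite set $A \cup \operatorname{supp}(p_1)$. DSONC cone. The fixed sign distribution is a disjoint union $A = A^+ \cup A^-$ with $A^+ \subset (2\mathbb{N})^n$. For $\boldsymbol\beta \in A^-$, the dual SONC cone $\check{S}_{A^+,\boldsymbol\beta}$ is the set of vectors $\mathbf{c} = (c_{\boldsymbol\alpha})_{\boldsymbol\alpha \in A^+ \cup \{\boldsymbol\beta\}}$ of real numbers with $c_{\boldsymbol\alpha} \ge 0$ for all $\boldsymbol\alpha \in A^+$ for which there exists $\boldsymbol\tau \in \mathbb{R}^n$ with $$\ln\left(\frac{|c_{\boldsymbol\beta}|}{c_{\boldsymbol\alpha}}\right) \le (\boldsymbol\alpha - \boldsymbol\beta)^T \boldsymbol\tau \quad \text{for all } \boldsymbol\alpha \in A^+,$$ read as $|c_{\boldsymbol\beta}| \le c_{\boldsymbol\alpha}\exp((\boldsymbol\alpha - \boldsymbol\beta)^T\boldsymbol\tau)$ when a coefficient vanishes. The signed DSONC cone is the Minkowski sum $$\mathcal{D}_{A^+,A^-} = \sum_{\boldsymbol\beta \in A^-} \Big\{ \sum_{\boldsymbol\alpha \in A^+} c_{\boldsymbol\alpha}\mathbf{x}^{\boldsymbol\alpha} + c_{\boldsymbol\beta}\mathbf{x}^{\boldsymbol\beta}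 : \mathbf{c} \in \check{S}_{A^+,\boldsymbol\beta} \Big\}.$$ A relative entropy program (REP) is an optimization problem: minimize $f(\mathbf{x})$ subject to $g_i(\mathbf{x}) \ge 0$ for $i = 1,\dots,m$ and $\mathbf{x} \in \mathcal{R}_N$, where $f, g_1, \dots, g_m$ are linear (possibly with constant term) and $\mathcal{R}_N = \{(\mathbf{y},\mathbf{z},\mathbf{t}) \in \mathbb{R}^N \times \mathbb{R}^N \times \mathbb{R}^N : y_j \ln(y_j/z_j) \le t_j \text{ for all } j\}$ is the relative entropy cone, with $\mathbf{y},\mathbf{z} \ge 0$, $0 \ln (0/z) = 0$, and $y\ln(y/0) = +\infty$ for $y > 0$. Variables of the problem may appear as linear functions of the coordinates $(\mathbf{y},\mathbf{z},\mathbf{t})$. *)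

theory Defs
  imports "HOL-Analysis.Analysis" "HOL-Library.Poly_Mapping" "HOL-Library.Set_Algebras"
begin

section \<open>Polynomials in the variables indexed by a finite type\<close>

text \<open>Exponents are vectors in \<^typ>\<open>nat ^ 'n\<close>. The ring structure on polynomials is the
  convolution product of \<^theory>\<open>HOL-Library.Poly_Mapping\<close>.\<close>

type_synonym 'n mpoly = "(nat ^ 'n) \<Rightarrow>\<^sub>0 real"

abbreviation coeff :: "'n mpoly \<Rightarrow> nat ^ 'n \<Rightarrow> real" where
  "coeff \<equiv> Poly_Mapping.lookup"

abbreviation supp :: "'n mpoly \<Rightarrow> (nat ^ 'n) set" where
  "supp \<equiv> Poly_Mapping.keys"

abbreviation monomial :: "nat ^ 'n \<Rightarrow> real \<Rightarrow> 'n mpoly" where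
  "monomial \<equiv> Poly_Mapping.single"

definition mpoly_eval :: "'n::finite mpoly \<Rightarrow> real ^ 'n \<Rightarrow> real" where
  "mpoly_eval p x = (\<Sum>\<alpha>\<in>supp p. coeff p \<alpha> * (\<Prod>i\<in>UNIV. (x $ i) ^ (\<alpha> $ i)))"

text \<open>The subtraction of exponents truncates, but only in terms whose coefficient vanishes.\<close>

definition partial_deriv :: "'n::finite \<Rightarrow> 'n mpoly \<Rightarrow> 'n mpoly" where
  "partial_deriv i p =
     (\<Sum>\<alpha>\<in>supp p. monomial (\<alpha> - axis i 1) (real (\<alpha> $ i) * coeff p \<alpha>))"

definition orbital_deriv :: "'n::finite mpoly ^ 'n \<Rightarrow> 'n mpoly \<Rightarrow> 'n mpoly" where
  "orbital_deriv f V = (\<Sum>i\<in>UNIV. partial_deriv i V * f $ i)"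


section \<open>The signed DSONC cone\<close>

definition exponent_diff :: "nat ^ 'n \<Rightarrow> nat ^ 'n \<Rightarrow> real ^ 'n" where
  "exponent_diff \<alpha> \<beta> = (\<chi> i. real (\<alpha> $ i) - real (\<beta> $ i))"

text \<open>Coefficient vectors are total functions; only their values on
  \<^term>\<open>Ap \<union> {\<beta>}\<close> matter.\<close>

definition dual_sonc :: "(nat ^ 'n::finite) set \<Rightarrow> nat ^ 'n \<Rightarrow> (nat ^ 'n \<Rightarrow> real) set" where
  "dual_sonc Ap \<beta> =
     {c. (\<forall>\<alpha>\<in>Ap. 0 \<le> c \<alpha>) \<and>
         (\<exists>\<tau> :: real ^ 'n. \<forall>\<alpha>\<in>Ap.
            if c \<alpha> = 0 \<or> c \<beta> = 0
            then \<bar>c \<beta>\<bar> \<le> c \<alpha> * exp (exponent_diff \<alpha> \<beta> \<bullet> \<tau>)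
            else ln (\<bar>c \<beta>\<bar> / c \<alpha>) \<le> exponent_diff \<alpha> \<beta> \<bullet> \<tau>)}"

definition dsonc_summand :: "(nat ^ 'n::finite) set \<Rightarrow> nat ^ 'n \<Rightarrow> 'n mpoly set" where
  "dsonc_summand Ap \<beta> =
     {(\<Sum>\<alpha>\<in>Ap. monomial \<alpha> (c \<alpha>)) + monomial \<beta> (c \<beta>) | c. c \<in> dual_sonc Ap \<beta>}"

text \<open>The sum below is the Minkowski sum of sets from \<^theory>\<open>HOL-Library.Set_Algebras\<close>; it is
  \<^term>\<open>{0}\<close> if \<^term>\<open>Am\<close> is empty.\<close>

definition dsonc :: "(nat ^ 'n::finite) set \<Rightarrow> (nat ^ 'n) set \<Rightarrow> 'n mpoly set" where
  "dsonc Ap Am = (\<Sum>\<beta>\<in>Am. dsonc_summand Ap \<beta>)"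


section \<open>Relative entropy programs\<close>

definition rel_entropy :: "real \<Rightarrow> real \<Rightarrow> ereal" where
  "rel_entropy y z = (if y = 0 then 0 else if z = 0 then \<infinity> else ereal (y * ln (y / z)))"

text \<open>A triple \<open>(y, z, t)\<close> of sequences stands for a point of the \<open>3N\<close>-dimensional space with
  coordinates \<open>y j\<close>, \<open>z j\<close>, \<open>t j\<close> for \<open>j < N\<close>; later entries are ignored throughout.\<close>

type_synonym rep_point = "(nat \<Rightarrow> real) \<times> (nat \<Rightarrow> real) \<times> (nat \<Rightarrow> real)"

definition rel_entropy_cone :: "nat \<Rightarrow> rep_point set" where
  "rel_entropy_cone N =
     {(y, z, t). \<forall>j<N. 0 \<le> y j \<and> 0 \<le> z j \<and> rel_entropy (y j) (z j) \<le> ereal (t j)}"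

definition linear_function :: "nat \<Rightarrow> (rep_point \<Rightarrow> real) \<Rightarrow> bool" where
  "linear_function N g \<longleftrightarrow>
     (\<exists>a b c. \<forall>y z t. g (y, z, t) = (\<Sum>j<N. a j * y j + b j * z j + c j * t j))"

definition affine_function :: "nat \<Rightarrow> (rep_point \<Rightarrow> real) \<Rightarrow> bool" where
  "affine_function N g \<longleftrightarrow> (\<exists>h d. linear_function N h \<and> (\<forall>x. g x = h x + d))"

record rep =
  rep_size :: nat
  rep_objective :: "rep_point \<Rightarrow> real"
  rep_constraints :: "(rep_point \<Rightarrow> real) list"

definition is_rep :: "rep \<Rightarrow> bool" where
  "is_rep P \<longleftrightarrow>
     affine_function (rep_size P) (rep_objective P) \<and>
     (\<forall>g\<in>set (rep_constraints P). affine_function (rep_size P) g)"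

definition rep_feasible :: "rep \<Rightarrow> rep_point set" where
  "rep_feasible P =
     {x \<in> rel_entropy_cone (rep_size P). \<forall>g\<in>set (rep_constraints P). 0 \<le> g x}"

text \<open>The program has, among its variables, the coefficients at the exponents in \<open>S\<close> of an unknown
  polynomial; each of them is a linear function \<open>L \<alpha>\<close> of the coordinates. The coefficient vector of a
  polynomial supported in \<open>S\<close> extends to a feasible point iff some feasible point has these
  coefficients as the values of the \<open>L \<alpha>\<close>.\<close>

definition coeffs_extend_to_feasible ::
    "rep \<Rightarrow> (nat ^ 'n \<Rightarrow> rep_point \<Rightarrow> real) \<Rightarrow> (nat ^ 'n) set \<Rightarrow> 'n mpoly \<Rightarrow> bool" where
  "coeffs_extend_to_feasible P L S V \<longleftrightarrow>
     supp V \<subseteq> S \<and> (\<exists>x\<in>rep_feasible P. \<forall>\<alpha>\<in>S. L \<alpha> x = coeff V \<alpha>)"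

definition stated_as_rep :: "(nat ^ 'n) set \<Rightarrow> ('n mpoly \<Rightarrow> bool) \<Rightarrow> bool" where
  "stated_as_rep S C \<longleftrightarrow>
     (\<exists>P L. is_rep P \<and> (\<forall>\<alpha>\<in>S. linear_function (rep_size P) (L \<alpha>)) \<and>
            (\<forall>V. C V \<longleftrightarrow> coeffs_extend_to_feasible P L S V))"

end

theory Submission imports Defs begin

text \<open>Membership in the DSONC cone asks for coefficients \<open>c \<beta> \<alpha>\<close> subject to linear equations and to
  \<open>ln (\<bar>c \<beta> \<beta>\<bar> / c \<beta> \<alpha>) \<le> (\<alpha> - \<beta>)\<^sup>T \<tau>\<close>. Multiplied by an upper bound \<open>y\<close> of \<open>\<bar>c \<beta> \<beta>\<bar>\<close>, the latter
  becomes \<open>y ln (y / c \<beta> \<alpha>) \<le> (\<alpha> - \<beta>)\<^sup>T \<tau>'\<close> with the free vector \<open>\<tau>' = y \<tau>\<close>, a relative entropy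
  constraint in linear functions of the unknowns. The coefficients of \<open>V - p1\<close> and of the orbital
  derivative depend affinely on those of \<open>V\<close>, whose support is confined to a finite set.\<close>

section \<open>Conditions expressible by relative entropy constraints\<close>

text \<open>Unknowns are values of a function on an arbitrary index type, so that they can carry
  descriptive names; numbering them as coordinates of a program is postponed to
  \<open>entropic_projection\<close>.\<close>

definition affine_form :: "'i set \<Rightarrow> (('i \<Rightarrow> real) \<Rightarrow> real) \<Rightarrow> bool" where
  "affine_form I g \<longleftrightarrow> (\<exists>a d. \<forall>x. g x = (\<Sum>i\<in>I. a i * x i) + d)"

lemma affine_form_const: "affine_form I (\<lambda>x. d)"
  unfolding affine_form_def by (intro exI[of _ "\<lambda>_. 0"] exI[of _ d]) simp

lemma affine_form_var:
  assumes "finite I" "i \<in> I"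
  shows "affine_form I (\<lambda>x. x i)"
  unfolding affine_form_def
  by (intro exI[of _ "\<lambda>j. if j = i then 1 else 0"] exI[of _ 0]) (simp add: assms mult_delta_left)

lemma affine_form_add:
  assumes "affine_form I g" "affine_form I h"
  shows "affine_form I (\<lambda>x. g x + h x)"
proof -
  from assms obtain a d b e where "\<And>x. g x = (\<Sum>i\<in>I. a i * x i) + d" "\<And>x. h x = (\<Sum>i\<in>I. b i * x i) + e"
    unfolding affine_form_def by blast
  then show ?thesis unfolding affine_form_def
    by (intro exI[of _ "\<lambda>i. a i + b i"] exI[of _ "d + e"]) (simp add: sum.distrib distrib_right)
qed

lemma affine_form_scale:
  assumes "affine_form I g"
  shows "affine_form I (\<lambda>x. r * g x)"
proof -
  from assms obtain a d where "\<And>x. g x = (\<Sum>i\<in>I. a i * x i) + d"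
    unfolding affine_form_def by blast
  then show ?thesis unfolding affine_form_def
    by (intro exI[of _ "\<lambda>i. r * a i"] exI[of _ "r * d"]) (simp add: sum_distrib_left distrib_left mult.assoc)
qed

lemma affine_form_uminus:
  assumes "affine_form I g"
  shows "affine_form I (\<lambda>x. - g x)"
  using affine_form_scale[OF assms, of "-1"] by simp

lemma affine_form_diff:
  assumes "affine_form I g" "affine_form I h"
  shows "affine_form I (\<lambda>x. g x - h x)"
  using affine_form_add[OF assms(1) affine_form_uminus[OF assms(2)]] by simp

lemma affine_form_sum:
  assumes "\<And>k. k \<in> K \<Longrightarrow> affine_form I (g k)"
  shows "affine_form I (\<lambda>x. \<Sum>k\<in>K. g k x)"
  using assms by (induction K rule: infinite_finite_induct) (simp_all add: affine_form_const affine_form_add)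

text \<open>There is no rule for existential quantifiers: auxiliary unknowns are simply further
  indices in \<open>I\<close>, projected away only at the end. The second rule has the shape of the
  cone condition on a single coordinate triple.\<close>

inductive entropic :: "'i set \<Rightarrow> (('i \<Rightarrow> real) \<Rightarrow> bool) \<Rightarrow> bool" for I where
  entropic_nonneg: "affine_form I g \<Longrightarrow> entropic I (\<lambda>x. 0 \<le> g x)"
| entropic_rel_entropy:
    "\<lbrakk>affine_form I Y; affine_form I Z; affine_form I T\<rbrakk> \<Longrightarrow>
      entropic I (\<lambda>x. 0 \<le> Y x \<and> 0 \<le> Z x \<and> rel_entropy (Y x) (Z x) \<le> ereal (T x))"
| entropic_conj: "\<lbrakk>entropic I Q; entropic I R\<rbrakk> \<Longrightarrow> entropic I (\<lambda>x. Q x \<and> R x)"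

lemma entropic_True: "entropic I (\<lambda>x. True)"
  using entropic_nonneg[OF affine_form_const[of I 0]] by simp

lemma entropic_le:
  assumes "affine_form I g" "affine_form I h"
  shows "entropic I (\<lambda>x. g x \<le> h x)"
  using entropic_nonneg[OF affine_form_diff[OF assms(2,1)]] by simp

lemma entropic_eq:
  assumes "affine_form I g" "affine_form I h"
  shows "entropic I (\<lambda>x. g x = h x)"
  using entropic_conj[OF entropic_le[OF assms] entropic_le[OF assms(2,1)]] by (simp add: order_eq_iff)

lemma entropic_Ball:
  assumes "finite K" "\<And>k. k \<in> K \<Longrightarrow> entropic I (Q k)"
  shows "entropic I (\<lambda>x. \<forall>k\<in>K. Q k x)"
  using assms by (induction K) (simp_all add: entropic_True entropic_conj)

lemma affine_form_cong:
  assumes "affine_form I g" "\<And>i. i \<in> I \<Longrightarrow> x i = x' i"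
  shows "g x = g x'"
proof -
  from assms(1) obtain a d where "\<And>x. g x = (\<Sum>i\<in>I. a i * x i) + d"
    unfolding affine_form_def by blast
  then show ?thesis using assms(2) by simp
qed

text \<open>Needed because program coordinates determine an assignment only on
  \<open>I\<close>.\<close>

lemma entropic_cong:
  assumes "entropic I Q" "\<And>i. i \<in> I \<Longrightarrow> x i = x' i"
  shows "Q x \<longleftrightarrow> Q x'"
  using assms
proof induction
  case (entropic_nonneg g)
  then show ?case using affine_form_cong[of I g x x'] by simp
next
  case (entropic_rel_entropy Y Z T)
  then show ?case
    using affine_form_cong[of I Y x x'] affine_form_cong[of I Z x x'] affine_form_cong[of I T x x'] by simp
qed auto

section \<open>Translation into relative entropy programs\<close>

lemma affine_functionE:
  assumes "affine_function N g"
  obtains a b c d where "\<And>y z t. g (y, z, t) = (\<Sum>j<N. a j * y j + b j * z j + c j * t j) + d"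
proof -
  from assms obtain h d where h: "linear_function N h" and g: "\<And>p. g p = h p + d"
    unfolding affine_function_def by blast
  from h obtain a b c where "\<And>y z t. h (y, z, t) = (\<Sum>j<N. a j * y j + b j * z j + c j * t j)"
    unfolding linear_function_def by blast
  with g that show thesis by simp
qed

lemma affine_functionI:
  assumes "\<And>y z t. g (y, z, t) = (\<Sum>j<N. a j * y j + b j * z j + c j * t j) + d"
  shows "affine_function N g"
proof -
  let ?h = "\<lambda>(y, z, t). \<Sum>j<N. a j * y j + b j * z j + c j * t j"
  have "linear_function N ?h" unfolding linear_function_def by auto
  moreover have "\<forall>p. g p = ?h p + d" using assms by auto
  ultimately show ?thesis unfolding affine_function_def by blast
qed

lemma affine_function_const: "affine_function N (\<lambda>p. d)"
  by (rule affine_functionI[where a = "\<lambda>_. 0" and b = "\<lambda>_. 0" and c = "\<lambda>_. 0" and d = d]) simp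

lemma affine_function_coordinates:
  assumes "k < N"
  shows "affine_function N (\<lambda>p. fst p k)"
    and "affine_function N (\<lambda>p. fst (snd p) k)"
    and "affine_function N (\<lambda>p. snd (snd p) k)"
  by (rule affine_functionI[where a = "\<lambda>j. if j = k then 1 else 0" and b = "\<lambda>_. 0" and c = "\<lambda>_. 0" and d = 0],
      simp add: assms mult_delta_left)
    (rule affine_functionI[where a = "\<lambda>_. 0" and b = "\<lambda>j. if j = k then 1 else 0" and c = "\<lambda>_. 0" and d = 0],
      simp add: assms mult_delta_left,
     rule affine_functionI[where a = "\<lambda>_. 0" and b = "\<lambda>_. 0" and c = "\<lambda>j. if j = k then 1 else 0" and d = 0],
      simp add: assms mult_delta_left)

lemma affine_function_add:
  assumes "affine_function N g" "affine_function N h"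
  shows "affine_function N (\<lambda>p. g p + h p)"
proof -
  from assms(1) obtain a b c d where
    g: "\<And>y z t. g (y, z, t) = (\<Sum>j<N. a j * y j + b j * z j + c j * t j) + d"
    by (rule affine_functionE) blast
  from assms(2) obtain a' b' c' d' where
    h: "\<And>y z t. h (y, z, t) = (\<Sum>j<N. a' j * y j + b' j * z j + c' j * t j) + d'"
    by (rule affine_functionE) blast
  show ?thesis
    by (rule affine_functionI[where a = "\<lambda>j. a j + a' j" and b = "\<lambda>j. b j + b' j" and c = "\<lambda>j. c j + c' j" and d = "d + d'"])
      (simp add: g h sum.distrib distrib_right)
qed

lemma affine_function_scale:
  assumes "affine_function N g"
  shows "affine_function N (\<lambda>p. r * g p)"
proof -
  from assms obtain a b c d where
    g: "\<And>y z t. g (y, z, t) = (\<Sum>j<N. a j * y j + b j * z j + c j * t j) + d"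
    by (rule affine_functionE) blast
  show ?thesis
    by (rule affine_functionI[where a = "\<lambda>j. r * a j" and b = "\<lambda>j. r * b j" and c = "\<lambda>j. r * c j" and d = "r * d"])
      (simp add: g sum_distrib_left distrib_left mult.assoc)
qed

lemma affine_function_diff:
  assumes "affine_function N g" "affine_function N h"
  shows "affine_function N (\<lambda>p. g p - h p)"
  using affine_function_add[OF assms(1) affine_function_scale[OF assms(2), of "-1"]] by simp

lemma affine_function_sum:
  assumes "\<And>k. k \<in> K \<Longrightarrow> affine_function N (g k)"
  shows "affine_function N (\<lambda>p. \<Sum>k\<in>K. g k p)"
  using assms
  by (induction K rule: infinite_finite_induct) (simp_all add: affine_function_const affine_function_add)

lemma affine_function_mono:
  assumes "affine_function M g" "M \<le> N"
  shows "affine_function N g"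
proof -
  from assms(1) obtain a b c d where g:
    "\<And>y z t. g (y, z, t) = (\<Sum>j<M. a j * y j + b j * z j + c j * t j) + d"
    by (rule affine_functionE) blast
  let ?cut = "\<lambda>a j. if j < M then a j else (0 :: real)"
  have "(\<Sum>j<M. a j * y j + b j * z j + c j * t j) =
      (\<Sum>j<N. ?cut a j * y j + ?cut b j * z j + ?cut c j * t j)" for y z t
    using assms(2) by (intro sum.mono_neutral_cong_left) auto
  with g show ?thesis
    by (intro affine_functionI[where a = "?cut a" and b = "?cut b" and c = "?cut c" and d = d]) simp
qed

text \<open>Read as: \<open>q\<close> extends the first \<open>N\<close> triples of \<open>p\<close>
  by arbitrary later entries. This is how a program is enlarged without disturbing the coordinates
  already in use.\<close>

definition agree :: "nat \<Rightarrow> rep_point \<Rightarrow> rep_point \<Rightarrow> bool" where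
  "agree N p q \<longleftrightarrow> (\<forall>j<N. fst p j = fst q j \<and> fst (snd p) j = fst (snd q) j \<and> snd (snd p) j = snd (snd q) j)"

lemma agree_refl: "agree N p p"
  by (simp add: agree_def)

lemma affine_function_agree:
  assumes "affine_function N g" "agree N p q"
  shows "g p = g q"
proof -
  from assms(1) obtain a b c d where g:
    "\<And>y z t. g (y, z, t) = (\<Sum>j<N. a j * y j + b j * z j + c j * t j) + d"
    by (rule affine_functionE) blast
  obtain y z t y' z' t' where "p = (y, z, t)" "q = (y', z', t')" by (metis prod.exhaust)
  with assms(2) show ?thesis by (simp add: g agree_def)
qed

lemma rel_entropy_cone_iff:
  "p \<in> rel_entropy_cone N \<longleftrightarrow>
    (\<forall>j<N. 0 \<le> fst p j \<and> 0 \<le> fst (snd p) j \<and> rel_entropy (fst p j) (fst (snd p) j) \<le> ereal (snd (snd p) j))"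
  unfolding rel_entropy_cone_def by (cases p) auto

lemma rel_entropy_cone_agree:
  assumes "agree N p q"
  shows "p \<in> rel_entropy_cone N \<longleftrightarrow> q \<in> rel_entropy_cone N"
  using assms unfolding rel_entropy_cone_iff agree_def by simp

lemma affine_function_affine_form:
  assumes "affine_form I g" "e ` I \<subseteq> {..<N}"
  shows "affine_function N (\<lambda>p. g (\<lambda>i. snd (snd p) (e i)))"
proof -
  from assms obtain a d where "\<And>x. g x = (\<Sum>i\<in>I. a i * x i) + d"
    unfolding affine_form_def by blast
  moreover have "affine_function N (\<lambda>p. (\<Sum>i\<in>I. a i * snd (snd p) (e i)) + d)"
    using assms(2)
    by (intro affine_function_add affine_function_sum affine_function_scale affine_function_const
        affine_function_coordinates) auto
  ultimately show ?thesis by simp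
qed

text \<open>The unknown \<open>x i\<close> is the coordinate \<open>t (e i)\<close>. Each entropy constraint occupies one fresh triple
  of coordinates, tied to the arguments of the constraint by linear equations.\<close>

lemma entropic_extension:
  assumes "entropic I Q" "e ` I \<subseteq> {..<N}"
  shows "\<exists>N' gs. N \<le> N' \<and> (\<forall>g\<in>set gs. affine_function N' g) \<and>
    (\<forall>p. (\<exists>q\<in>rel_entropy_cone N'. agree N p q \<and> (\<forall>g\<in>set gs. 0 \<le> g q)) \<longleftrightarrow>
         p \<in> rel_entropy_cone N \<and> Q (\<lambda>i. snd (snd p) (e i)))"
  using assms
\<comment> \<open>\<open>N\<close> is generalised because the second conjunct is translated on top
  of the program already built for the first.\<close>
proof (induction arbitrary: N)
  case (entropic_nonneg g)
  let ?g = "\<lambda>p. g (\<lambda>i. snd (snd p) (e i))"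
  have g: "affine_function N ?g"
    by (rule affine_function_affine_form) fact+
  have "(\<exists>q\<in>rel_entropy_cone N. agree N p q \<and> 0 \<le> ?g q) \<longleftrightarrow> p \<in> rel_entropy_cone N \<and> 0 \<le> ?g p" for p
    using affine_function_agree[OF g] rel_entropy_cone_agree agree_refl by metis
  with g show ?case by (intro exI[of _ N] exI[of _ "[?g]"] conjI allI) simp_all
next
  case (entropic_rel_entropy Y Z T)
  define lift :: "(('a \<Rightarrow> real) \<Rightarrow> real) \<Rightarrow> rep_point \<Rightarrow> real"
    where "lift g p = g (\<lambda>i. snd (snd p) (e i))" for g p
  have lift: "affine_function N (lift Y)" "affine_function N (lift Z)" "affine_function N (lift T)"
    using entropic_rel_entropy affine_function_affine_form unfolding lift_def by blast+
  then have lift': "affine_function (Suc N) (lift Y)" "affine_function (Suc N) (lift Z)"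
      "affine_function (Suc N) (lift T)"
    by (auto intro: affine_function_mono)
  \<comment> \<open>Program constraints are inequalities \<open>0 \<le> g\<close>, so each of the
    three equations for the fresh triple, which has index \<open>N\<close>, becomes two opposite
    inequalities.\<close>
  define gs where "gs =
    [\<lambda>p. fst p N - lift Y p, \<lambda>p. lift Y p - fst p N,
     \<lambda>p. fst (snd p) N - lift Z p, \<lambda>p. lift Z p - fst (snd p) N,
     \<lambda>p. snd (snd p) N - lift T p, \<lambda>p. lift T p - snd (snd p) N]"
  have gs: "\<forall>g\<in>set gs. affine_function (Suc N) g"
    using lift' by (auto simp: gs_def intro!: affine_function_diff affine_function_coordinates)
  have gs_iff: "(\<forall>g\<in>set gs. 0 \<le> g q) \<longleftrightarrow>
      fst q N = lift Y q \<and> fst (snd q) N = lift Z q \<and> snd (snd q) N = lift T q" for q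
    by (auto simp: gs_def)
  have "(\<exists>q\<in>rel_entropy_cone (Suc N). agree N p q \<and> (\<forall>g\<in>set gs. 0 \<le> g q)) \<longleftrightarrow>
      p \<in> rel_entropy_cone N \<and> 0 \<le> lift Y p \<and> 0 \<le> lift Z p \<and>
      rel_entropy (lift Y p) (lift Z p) \<le> ereal (lift T p)" (is "?l \<longleftrightarrow> ?r") for p
  proof
    assume ?l
    then obtain q where q: "q \<in> rel_entropy_cone (Suc N)" "agree N p q"
      "fst q N = lift Y q" "fst (snd q) N = lift Z q" "snd (snd q) N = lift T q"
      unfolding gs_iff by blast
    have eq: "lift Y p = fst q N" "lift Z p = fst (snd q) N" "lift T p = snd (snd q) N"
      using lift[THEN affine_function_agree, OF q(2)] q by auto
    from q have "q \<in> rel_entropy_cone N" by (auto simp: rel_entropy_cone_iff)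
    with q(1,2) show ?r
      unfolding eq using rel_entropy_cone_agree[OF q(2)] by (simp add: rel_entropy_cone_iff[of q "Suc N"])
  next
    assume r: ?r
    \<comment> \<open>Overwriting index \<open>N\<close> leaves the triples below \<open>N\<close>
      unchanged, and with them the values of \<open>Y\<close>, \<open>Z\<close> and
      \<open>T\<close>.\<close>
    define q where "q = ((fst p)(N := lift Y p), (fst (snd p))(N := lift Z p), (snd (snd p))(N := lift T p))"
    have q: "agree N p q" by (simp add: q_def agree_def)
    have eq: "lift Y p = lift Y q" "lift Z p = lift Z q" "lift T p = lift T q"
      using lift[THEN affine_function_agree, OF q] by auto
    have "q \<in> rel_entropy_cone (Suc N)"
      using r by (auto simp: rel_entropy_cone_iff q_def less_Suc_eq)
    moreover have "\<forall>g\<in>set gs. 0 \<le> g q" unfolding gs_iff eq[symmetric] by (simp add: q_def)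
    ultimately show ?l using q by blast
  qed
  with gs show ?case unfolding lift_def by (intro exI[of _ "Suc N"] exI[of _ gs] conjI allI) simp_all
next
  case (entropic_conj Q R)
  let ?x = "\<lambda>p :: rep_point. \<lambda>i. snd (snd p) (e i)"
  from entropic_conj.IH(1)[OF entropic_conj.prems] obtain M gs where M: "N \<le> M" "\<forall>g\<in>set gs. affine_function M g"
    "\<And>p. (\<exists>q\<in>rel_entropy_cone M. agree N p q \<and> (\<forall>g\<in>set gs. 0 \<le> g q)) \<longleftrightarrow>
         p \<in> rel_entropy_cone N \<and> Q (?x p)"
    by (elim exE conjE) (rule that, blast+)
  from entropic_conj.prems M(1) have IM: "e ` I \<subseteq> {..<M}" by auto
  from entropic_conj.IH(2)[OF IM] obtain M' hs where M': "M \<le> M'" "\<forall>g\<in>set hs. affine_function M' g"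
    "\<And>p. (\<exists>q\<in>rel_entropy_cone M'. agree M p q \<and> (\<forall>g\<in>set hs. 0 \<le> g q)) \<longleftrightarrow>
         p \<in> rel_entropy_cone M \<and> R (?x p)"
    by (elim exE conjE) (rule that, blast+)
  \<comment> \<open>\<open>e\<close> maps \<open>I\<close> below \<open>N\<close>, so extending
    \<open>p\<close> does not alter the unknowns in \<open>I\<close>.\<close>
  have agree_R: "R (?x p) \<longleftrightarrow> R (?x q)" if "agree N p q" for p q
    using that entropic_conj.prems
    by (intro entropic_cong[OF entropic_conj.hyps(2)]) (auto simp: agree_def)
  have "(\<exists>q\<in>rel_entropy_cone M'. agree N p q \<and> (\<forall>g\<in>set (gs @ hs). 0 \<le> g q)) \<longleftrightarrow>
      p \<in> rel_entropy_cone N \<and> Q (?x p) \<and> R (?x p)" (is "?l \<longleftrightarrow> ?r") for p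
  proof
    assume ?l
    then obtain q where q: "q \<in> rel_entropy_cone M'" "agree N p q"
      "\<forall>g\<in>set gs. 0 \<le> g q" "\<forall>g\<in>set hs. 0 \<le> g q" by auto
    from q agree_refl[of M q] M'(3) have "q \<in> rel_entropy_cone M" "R (?x q)" by blast+
    with q M(3) agree_R show ?r by blast
  next
    assume r: ?r
    then obtain q where q: "q \<in> rel_entropy_cone M" "agree N p q" "\<forall>g\<in>set gs. 0 \<le> g q"
      using M(3) by blast
    with r agree_R have "R (?x q)" by blast
    with q M'(3) obtain q' where q': "q' \<in> rel_entropy_cone M'" "agree M q q'" "\<forall>g\<in>set hs. 0 \<le> g q'"
      by blast
    \<comment> \<open>The constraints in \<open>gs\<close> involve only the first \<open>M\<close>
      triples, which the second extension keeps.\<close>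
    have "\<forall>g\<in>set gs. 0 \<le> g q'"
    proof
      fix g assume "g \<in> set gs"
      with M(2) have "affine_function M g" by blast
      from affine_function_agree[OF this q'(2)] \<open>g \<in> set gs\<close> q(3) show "0 \<le> g q'" by metis
    qed
    moreover have "agree N p q'" using q(2) q'(2) M(1) by (auto simp: agree_def)
    ultimately show ?l using q' by (intro bexI[of _ q']) auto
  qed
  moreover have "\<forall>g\<in>set (gs @ hs). affine_function M' g"
    using M(2) M'(1,2) by (auto intro: affine_function_mono)
  ultimately show ?case
    using M(1) M'(1) by (intro exI[of _ M'] exI[of _ "gs @ hs"] conjI allI) simp_all
qed

section \<open>Projection onto designated unknowns\<close>

lemma linear_function_t_coordinate:
  assumes "k < N"
  shows "linear_function N (\<lambda>p. snd (snd p) k)"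
  unfolding linear_function_def
  by (rule exI[of _ "\<lambda>_. 0"], rule exI[of _ "\<lambda>_. 0"], rule exI[of _ "\<lambda>j. if j = k then 1 else 0"])
    (simp add: assms mult_delta_left)

text \<open>The unknowns in \<open>I\<close> are stored in t-coordinates, which can take any real
  value inside the cone. The map \<open>\<iota>\<close> selects those exposed through
  \<open>L\<close>; all others are quantified away by the existence of a feasible point.\<close>

lemma entropic_projection:
  assumes "finite I" "entropic I Q" "\<iota> ` S \<subseteq> I"
  shows "\<exists>P L. is_rep P \<and> (\<forall>\<alpha>\<in>S. linear_function (rep_size P) (L \<alpha>)) \<and>
    (\<forall>w. (\<exists>x. Q x \<and> (\<forall>\<alpha>\<in>S. x (\<iota> \<alpha>) = w \<alpha>)) \<longleftrightarrow> (\<exists>p\<in>rep_feasible P. \<forall>\<alpha>\<in>S. L \<alpha> p = w \<alpha>))"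
proof -
  define N where "N = card I"
  from \<open>finite I\<close> obtain e where e: "bij_betw e I {..<N}"
    unfolding N_def using ex_bij_betw_finite_nat[of I] by (metis atLeast0LessThan)
  then have eI: "e ` I \<subseteq> {..<N}" by (simp add: bij_betw_def)
  from entropic_extension[OF assms(2) eI] obtain N' gs where N': "N \<le> N'" "\<forall>g\<in>set gs. affine_function N' g"
    "\<And>p. (\<exists>q\<in>rel_entropy_cone N'. agree N p q \<and> (\<forall>g\<in>set gs. 0 \<le> g q)) \<longleftrightarrow>
         p \<in> rel_entropy_cone N \<and> Q (\<lambda>i. snd (snd p) (e i))" by blast
  \<comment> \<open>Only feasibility matters here, so the objective is constantly 0.\<close>
  define P where "P = \<lparr>rep_size = N', rep_objective = \<lambda>_. 0, rep_constraints = gs\<rparr>"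
  define L where "L \<alpha> p = snd (snd p) (e (\<iota> \<alpha>))" for \<alpha> and p :: rep_point
  have feas: "p \<in> rep_feasible P \<longleftrightarrow> p \<in> rel_entropy_cone N' \<and> (\<forall>g\<in>set gs. 0 \<le> g p)" for p
    by (simp add: rep_feasible_def P_def)
  have iota: "e (\<iota> \<alpha>) < N" if "\<alpha> \<in> S" for \<alpha> using that assms(3) eI by blast
  have "is_rep P" using N'(2) by (simp add: is_rep_def P_def affine_function_const)
  moreover have "\<forall>\<alpha>\<in>S. linear_function (rep_size P) (L \<alpha>)"
    unfolding L_def P_def using iota N'(1) by (auto intro!: linear_function_t_coordinate intro: less_le_trans)
  moreover have "(\<exists>x. Q x \<and> (\<forall>\<alpha>\<in>S. x (\<iota> \<alpha>) = w \<alpha>)) \<longleftrightarrow> (\<exists>p\<in>rep_feasible P. \<forall>\<alpha>\<in>S. L \<alpha> p = w \<alpha>)"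
    (is "?l \<longleftrightarrow> ?r") for w
  proof
    assume ?l
    then obtain x where x: "Q x" "\<forall>\<alpha>\<in>S. x (\<iota> \<alpha>) = w \<alpha>" by blast
    define t where "t = x \<circ> inv_into I e"
    have t: "t (e i) = x i" if "i \<in> I" for i
      using that e by (simp add: t_def bij_betw_def)
    \<comment> \<open>With \<open>y = 1\<close> and \<open>z = exp (- t)\<close> the entropy constraint \<open>y ln (y / z) \<le> t\<close> is tight for every real \<open>t\<close>.\<close>
    define p :: rep_point where "p = (\<lambda>_. 1, \<lambda>j. exp (- t j), t)"
    have "p \<in> rel_entropy_cone N"
      by (simp add: p_def rel_entropy_cone_iff rel_entropy_def ln_div)
    \<comment> \<open>\<open>t \<circ> e\<close> reproduces \<open>x\<close> only on
      \<open>I\<close>, which suffices because \<open>Q\<close> depends on no other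
      unknowns.\<close>
    moreover have "Q (\<lambda>i. snd (snd p) (e i))"
      using x(1) entropic_cong[OF assms(2), of x "t \<circ> e"] t by (simp add: p_def comp_def)
    ultimately obtain q where q: "q \<in> rep_feasible P" "agree N p q"
      using N'(3) unfolding feas by blast
    have "L \<alpha> q = w \<alpha>" if "\<alpha> \<in> S" for \<alpha>
    proof -
      have "L \<alpha> q = t (e (\<iota> \<alpha>))" using q(2) iota[OF that] by (simp add: agree_def L_def p_def)
      also have "\<dots> = w \<alpha>" using t that assms(3) x(2) by auto
      finally show ?thesis .
    qed
    with q show ?r by blast
  next
    assume ?r
    then obtain p where p: "p \<in> rep_feasible P" "\<forall>\<alpha>\<in>S. L \<alpha> p = w \<alpha>" by blast
    \<comment> \<open>A feasible point is its own extension.\<close>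
    from p(1) agree_refl[of N p] N'(3) have "Q (\<lambda>i. snd (snd p) (e i))" unfolding feas by blast
    with p(2) show ?l unfolding L_def by blast
  qed
  ultimately show ?thesis by blast
qed

section \<open>The DSONC cone\<close>

text \<open>The witnesses are \<open>y = \<bar>c \<beta>\<bar>\<close> and \<open>\<bar>c \<beta>\<bar> \<tau>\<close>; a larger \<open>y\<close> only strengthens the condition.\<close>

lemma dual_sonc_iff:
  "c \<in> dual_sonc Ap \<beta> \<longleftrightarrow>
    (\<exists>y \<tau>. \<bar>c \<beta>\<bar> \<le> y \<and>
      (\<forall>\<alpha>\<in>Ap. 0 \<le> c \<alpha> \<and> rel_entropy y (c \<alpha>) \<le> ereal (exponent_diff \<alpha> \<beta> \<bullet> \<tau>)))" (is "_ \<longleftrightarrow> ?r")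
proof
  assume "c \<in> dual_sonc Ap \<beta>"
  then obtain \<tau> where nonneg: "\<forall>\<alpha>\<in>Ap. 0 \<le> c \<alpha>" and \<tau>: "\<forall>\<alpha>\<in>Ap.
      if c \<alpha> = 0 \<or> c \<beta> = 0
      then \<bar>c \<beta>\<bar> \<le> c \<alpha> * exp (exponent_diff \<alpha> \<beta> \<bullet> \<tau>)
      else ln (\<bar>c \<beta>\<bar> / c \<alpha>) \<le> exponent_diff \<alpha> \<beta> \<bullet> \<tau>"
    unfolding dual_sonc_def by blast
  \<comment> \<open>If \<open>c \<alpha>\<close> vanishes, the exponential form of the condition
    forces \<open>c \<beta>\<close> to vanish too; whenever \<open>c \<beta>\<close> vanishes, both
    sides are 0.\<close>
  have "rel_entropy \<bar>c \<beta>\<bar> (c \<alpha>) \<le> ereal (exponent_diff \<alpha> \<beta> \<bullet> (\<bar>c \<beta>\<bar> *\<^sub>R \<tau>))" if "\<alpha> \<in> Ap" for \<alpha>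
    using \<tau>[rule_format, OF that]
    by (auto simp: rel_entropy_def intro!: mult_left_mono split: if_splits)
  with nonneg show ?r by blast
next
  assume ?r
  then obtain y \<tau> where y: "\<bar>c \<beta>\<bar> \<le> y" and nonneg: "\<forall>\<alpha>\<in>Ap. 0 \<le> c \<alpha>"
    and \<tau>: "\<forall>\<alpha>\<in>Ap. rel_entropy y (c \<alpha>) \<le> ereal (exponent_diff \<alpha> \<beta> \<bullet> \<tau>)" by blast
  have "if c \<alpha> = 0 \<or> c \<beta> = 0
      then \<bar>c \<beta>\<bar> \<le> c \<alpha> * exp (exponent_diff \<alpha> \<beta> \<bullet> (\<tau> /\<^sub>R y))
      else ln (\<bar>c \<beta>\<bar> / c \<alpha>) \<le> exponent_diff \<alpha> \<beta> \<bullet> (\<tau> /\<^sub>R y)" if "\<alpha> \<in> Ap" for \<alpha>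
  \<comment> \<open>For \<open>c \<beta> = 0\<close> the bound \<open>y\<close> may be 0, but
    division by it is harmless: the condition then only asks that \<open>c \<alpha>\<close> times a
    positive number be nonnegative.\<close>
  proof (cases "c \<beta> = 0")
    case True
    with nonneg that show ?thesis by simp
  next
    case False
    with y have "y > 0" by linarith
    \<comment> \<open>For \<open>y > 0\<close> and \<open>c \<alpha> = 0\<close> the relative
      entropy would be infinite, contradicting the real upper bound.\<close>
    with \<tau> that have "c \<alpha> \<noteq> 0" and le: "y * ln (y / c \<alpha>) \<le> exponent_diff \<alpha> \<beta> \<bullet> \<tau>"
      by (auto simp: rel_entropy_def split: if_splits)
    with nonneg that have "c \<alpha> > 0" by (simp add: order_less_le)
    with False y have "ln (\<bar>c \<beta>\<bar> / c \<alpha>) \<le> ln (y / c \<alpha>)"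
      by (simp add: divide_right_mono)
    also have "\<dots> \<le> exponent_diff \<alpha> \<beta> \<bullet> (\<tau> /\<^sub>R y)"
      using le \<open>y > 0\<close> by (simp add: field_simps)
    finally show ?thesis using False \<open>c \<alpha> \<noteq> 0\<close> by simp
  qed
  with nonneg show "c \<in> dual_sonc Ap \<beta>" unfolding dual_sonc_def by blast
qed

text \<open>Choosing one element of each summand, and then one coefficient vector for each element,
  turns the Minkowski sum into a single family \<open>c\<close>.\<close>

lemma dsonc_iff:
  assumes "finite Am"
  shows "W \<in> dsonc Ap Am \<longleftrightarrow>
    (\<exists>c. (\<forall>\<beta>\<in>Am. c \<beta> \<in> dual_sonc Ap \<beta>) \<and>
      W = (\<Sum>\<beta>\<in>Am. (\<Sum>\<alpha>\<in>Ap. monomial \<alpha> (c \<beta> \<alpha>)) + monomial \<beta> (c \<beta> \<beta>)))" (is "_ \<longleftrightarrow> ?r")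
proof
  assume "W \<in> dsonc Ap Am"
  then obtain s where s: "W = sum s Am" "\<forall>\<beta>\<in>Am. s \<beta> \<in> dsonc_summand Ap \<beta>"
    unfolding dsonc_def set_sum_alt[OF assms] by blast
  then obtain c where "\<forall>\<beta>\<in>Am. c \<beta> \<in> dual_sonc Ap \<beta> \<and>
      s \<beta> = (\<Sum>\<alpha>\<in>Ap. monomial \<alpha> (c \<beta> \<alpha>)) + monomial \<beta> (c \<beta> \<beta>)"
    unfolding dsonc_summand_def by (simp, metis)
  with s show ?r by (intro exI[of _ c]) (simp cong: sum.cong)
next
  assume ?r
  then show "W \<in> dsonc Ap Am"
    unfolding dsonc_def set_sum_alt[OF assms] dsonc_summand_def by fastforce
qed

text \<open>Applied to \<open>V - p1\<close>, this confines \<open>V\<close> to finitely many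
  coefficients, which makes the program finite.\<close>

lemma supp_dsonc:
  assumes "finite Am" "W \<in> dsonc Ap Am"
  shows "supp W \<subseteq> Ap \<union> Am"
proof
  fix \<gamma> assume \<gamma>: "\<gamma> \<in> supp W"
  from assms obtain c where "W = (\<Sum>\<beta>\<in>Am. (\<Sum>\<alpha>\<in>Ap. monomial \<alpha> (c \<beta> \<alpha>)) + monomial \<beta> (c \<beta> \<beta>))"
    unfolding dsonc_iff[OF assms(1)] by blast
  then have W: "coeff W \<gamma> = (\<Sum>\<beta>\<in>Am. (\<Sum>\<alpha>\<in>Ap. c \<beta> \<alpha> when \<alpha> = \<gamma>) + (c \<beta> \<beta> when \<beta> = \<gamma>))"
    by (simp add: lookup_sum lookup_add lookup_single)
  show "\<gamma> \<in> Ap \<union> Am"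
  proof (rule ccontr)
    assume "\<gamma> \<notin> Ap \<union> Am"
    then have "coeff W \<gamma> = 0" unfolding W by (intro sum.neutral) (auto simp: when_def intro!: sum.neutral)
    with \<gamma> show False by (simp add: in_keys_iff)
  qed
qed

text \<open>Off \<open>T\<close> both sides have coefficient 0, so for finite \<open>T\<close> the
  polynomial identity amounts to finitely many linear equations. \<open>T\<close> may exceed
  \<open>Ap \<union> Am\<close>, since \<open>W\<close> need not be supported there before
  membership is known; the equations then force the extra coefficients to vanish.\<close>

lemma dsonc_iff_coeffs:
  assumes "finite Am" "supp W \<subseteq> T" "Ap \<union> Am \<subseteq> T"
  shows "W \<in> dsonc Ap Am \<longleftrightarrow>
    (\<exists>c. (\<forall>\<beta>\<in>Am. c \<beta> \<in> dual_sonc Ap \<beta>) \<and>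
      (\<forall>\<gamma>\<in>T. coeff W \<gamma> = (\<Sum>\<beta>\<in>Am. (\<Sum>\<alpha>\<in>Ap. c \<beta> \<alpha> when \<alpha> = \<gamma>) + (c \<beta> \<beta> when \<beta> = \<gamma>))))"
proof -
  have "W = (\<Sum>\<beta>\<in>Am. (\<Sum>\<alpha>\<in>Ap. monomial \<alpha> (c \<beta> \<alpha>)) + monomial \<beta> (c \<beta> \<beta>)) \<longleftrightarrow>
      (\<forall>\<gamma>\<in>T. coeff W \<gamma> = (\<Sum>\<beta>\<in>Am. (\<Sum>\<alpha>\<in>Ap. c \<beta> \<alpha> when \<alpha> = \<gamma>) + (c \<beta> \<beta> when \<beta> = \<gamma>)))"
    (is "W = ?M \<longleftrightarrow> ?r") for c
  proof -
    have M: "coeff ?M \<gamma> = (\<Sum>\<beta>\<in>Am. (\<Sum>\<alpha>\<in>Ap. c \<beta> \<alpha> when \<alpha> = \<gamma>) + (c \<beta> \<beta> when \<beta> = \<gamma>))" for \<gamma>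
      by (simp add: lookup_sum lookup_add lookup_single)
    have "coeff W \<gamma> = coeff ?M \<gamma>" if "\<gamma> \<notin> T" for \<gamma>
    proof -
      have "coeff W \<gamma> = 0" using that assms(2) by (auto simp: in_keys_iff)
      moreover have "coeff ?M \<gamma> = 0"
        unfolding M using that assms(3) by (intro sum.neutral) (auto simp: when_def intro!: sum.neutral)
      ultimately show ?thesis by simp
    qed
    then have "W = ?M \<longleftrightarrow> (\<forall>\<gamma>\<in>T. coeff W \<gamma> = coeff ?M \<gamma>)"
      by (auto intro!: poly_mapping_eqI)
    then show ?thesis unfolding M .
  qed
  then show ?thesis unfolding dsonc_iff[OF assms(1)] by simp
qed

text \<open>Every clause is written in a form accepted by \<open>entropic\<close>: the absolute
  value is replaced by two linear bounds, the inner product is spelled out in scalar unknowns, and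
  \<open>0 \<le> y \<beta>\<close> is repeated for each \<open>\<alpha>\<close> to match the
  relative entropy rule.\<close>

definition dsonc_system ::
    "(nat ^ 'n::finite) set \<Rightarrow> (nat ^ 'n) set \<Rightarrow> (nat ^ 'n) set \<Rightarrow> (nat ^ 'n \<Rightarrow> real) \<Rightarrow>
     (nat ^ 'n \<Rightarrow> nat ^ 'n \<Rightarrow> real) \<Rightarrow> (nat ^ 'n \<Rightarrow> real) \<Rightarrow> (nat ^ 'n \<Rightarrow> 'n \<Rightarrow> real) \<Rightarrow> bool" where
  "dsonc_system Ap Am T w c y \<tau> \<longleftrightarrow>
    (\<forall>\<beta>\<in>Am. (c \<beta> \<beta> \<le> y \<beta> \<and> - c \<beta> \<beta> \<le> y \<beta>) \<and>
      (\<forall>\<alpha>\<in>Ap. 0 \<le> y \<beta> \<and> 0 \<le> c \<beta> \<alpha> \<and>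
        rel_entropy (y \<beta>) (c \<beta> \<alpha>) \<le> ereal (\<Sum>i\<in>UNIV. (real (\<alpha> $ i) - real (\<beta> $ i)) * \<tau> \<beta> i))) \<and>
    (\<forall>\<gamma>\<in>T. w \<gamma> = (\<Sum>\<beta>\<in>Am. (\<Sum>\<alpha>\<in>Ap. c \<beta> \<alpha> when \<alpha> = \<gamma>) + (c \<beta> \<beta> when \<beta> = \<gamma>)))"

lemma dsonc_iff_system:
  fixes W :: "'n::finite mpoly"
  assumes "finite Am" "supp W \<subseteq> T" "Ap \<union> Am \<subseteq> T"
  shows "W \<in> dsonc Ap Am \<longleftrightarrow> (\<exists>c y \<tau>. dsonc_system Ap Am T (coeff W) c y \<tau>)"
proof -
  have inner: "exponent_diff \<alpha> \<beta> \<bullet> \<tau> = (\<Sum>i\<in>UNIV. (real (\<alpha> $ i) - real (\<beta> $ i)) * \<tau> $ i)"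
    for \<alpha> \<beta> and \<tau> :: "real ^ 'n"
    by (simp add: inner_vec_def exponent_diff_def)
  have "(\<forall>\<beta>\<in>Am. c \<beta> \<in> dual_sonc Ap \<beta>) \<longleftrightarrow>
    (\<exists>y \<tau>. \<forall>\<beta>\<in>Am. (c \<beta> \<beta> \<le> y \<beta> \<and> - c \<beta> \<beta> \<le> y \<beta>) \<and>
      (\<forall>\<alpha>\<in>Ap. 0 \<le> y \<beta> \<and> 0 \<le> c \<beta> \<alpha> \<and>
        rel_entropy (y \<beta>) (c \<beta> \<alpha>) \<le> ereal (\<Sum>i\<in>UNIV. (real (\<alpha> $ i) - real (\<beta> $ i)) * \<tau> \<beta> i)))"
    (is "?l \<longleftrightarrow> ?r") for c
  proof
    assume ?l
    then obtain y \<tau> where *: "\<And>\<beta>. \<beta> \<in> Am \<Longrightarrow> \<bar>c \<beta> \<beta>\<bar> \<le> y \<beta> \<and>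
      (\<forall>\<alpha>\<in>Ap. 0 \<le> c \<beta> \<alpha> \<and> rel_entropy (y \<beta>) (c \<beta> \<alpha>) \<le> ereal (exponent_diff \<alpha> \<beta> \<bullet> \<tau> \<beta>))"
      unfolding dual_sonc_iff by metis
    show ?r
    proof (intro exI[of _ y] exI[of _ "\<lambda>\<beta> i. \<tau> \<beta> $ i"] ballI)
      fix \<beta> assume "\<beta> \<in> Am"
      from *[OF this] have "0 \<le> y \<beta>" by linarith
      with *[OF \<open>\<beta> \<in> Am\<close>] show "(c \<beta> \<beta> \<le> y \<beta> \<and> - c \<beta> \<beta> \<le> y \<beta>) \<and>
          (\<forall>\<alpha>\<in>Ap. 0 \<le> y \<beta> \<and> 0 \<le> c \<beta> \<alpha> \<and>
        rel_entropy (y \<beta>) (c \<beta> \<alpha>) \<le> ereal (\<Sum>i\<in>UNIV. (real (\<alpha> $ i) - real (\<beta> $ i)) * \<tau> \<beta> $ i))"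
        by (auto simp: inner)
    qed
  next
    assume ?r
    then obtain y \<tau> where *: "\<forall>\<beta>\<in>Am. (c \<beta> \<beta> \<le> y \<beta> \<and> - c \<beta> \<beta> \<le> y \<beta>) \<and>
      (\<forall>\<alpha>\<in>Ap. 0 \<le> y \<beta> \<and> 0 \<le> c \<beta> \<alpha> \<and>
        rel_entropy (y \<beta>) (c \<beta> \<alpha>) \<le> ereal (\<Sum>i\<in>UNIV. (real (\<alpha> $ i) - real (\<beta> $ i)) * \<tau> \<beta> i))"
      by blast
    show ?l
    proof
      fix \<beta> assume "\<beta> \<in> Am"
      with * show "c \<beta> \<in> dual_sonc Ap \<beta>" unfolding dual_sonc_iff inner
        by (intro exI[of _ "y \<beta>"] exI[of _ "\<chi> i. \<tau> \<beta> i"]) auto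
    qed
  qed
  then show ?thesis unfolding dsonc_iff_coeffs[OF assms] dsonc_system_def by simp
qed

section \<open>Polynomials depending affinely on the coefficients of the unknown\<close>

text \<open>\<open>B\<close> and \<open>D\<close> are polynomials rather than mere coefficient
  functions, so their supports are finite. For finite \<open>S\<close> this bounds the supports of
  all \<open>W V\<close> by one finite set.\<close>

definition coeffwise_affine :: "(nat ^ 'n::finite) set \<Rightarrow> ('n mpoly \<Rightarrow> 'n mpoly) \<Rightarrow> bool" where
  "coeffwise_affine S W \<longleftrightarrow>
    (\<exists>B D. \<forall>V. supp V \<subseteq> S \<longrightarrow> (\<forall>\<gamma>. coeff (W V) \<gamma> = coeff B \<gamma> + (\<Sum>\<alpha>\<in>S. coeff V \<alpha> * coeff (D \<alpha>) \<gamma>)))"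

lemma coeffwise_affine_id:
  assumes "finite S"
  shows "coeffwise_affine S (\<lambda>V. V)"
proof -
  have "coeff V \<gamma> = coeff 0 \<gamma> + (\<Sum>\<alpha>\<in>S. coeff V \<alpha> * coeff (monomial \<alpha> 1) \<gamma>)" if "supp V \<subseteq> S" for V \<gamma>
  proof -
    have "(\<Sum>\<alpha>\<in>S. coeff V \<alpha> * coeff (monomial \<alpha> 1) \<gamma>) = (\<Sum>\<alpha>\<in>S. if \<alpha> = \<gamma> then coeff V \<alpha> else 0)"
      by (intro sum.cong) (auto simp: lookup_single when_def)
    also have "\<dots> = coeff V \<gamma>" using assms that by (auto simp: in_keys_iff)
    finally show ?thesis by (simp only: lookup_zero add_0)
  qed
  then show ?thesis unfolding coeffwise_affine_def
    by (intro exI[of _ 0] exI[of _ "\<lambda>\<alpha>. monomial \<alpha> 1"] allI impI)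
qed

lemma coeffwise_affine_uminus:
  assumes "coeffwise_affine S W"
  shows "coeffwise_affine S (\<lambda>V. - W V)"
proof -
  from assms obtain B D where
    "\<forall>V. supp V \<subseteq> S \<longrightarrow> (\<forall>\<gamma>. coeff (W V) \<gamma> = coeff B \<gamma> + (\<Sum>\<alpha>\<in>S. coeff V \<alpha> * coeff (D \<alpha>) \<gamma>))"
    unfolding coeffwise_affine_def by blast
  then show ?thesis unfolding coeffwise_affine_def
    by (intro exI[of _ "- B"] exI[of _ "\<lambda>\<alpha>. - D \<alpha>"]) (simp add: sum_negf)
qed

lemma coeffwise_affine_diff_const:
  assumes "coeffwise_affine S W"
  shows "coeffwise_affine S (\<lambda>V. W V - p)"
proof -
  from assms obtain B D where
    "\<forall>V. supp V \<subseteq> S \<longrightarrow> (\<forall>\<gamma>. coeff (W V) \<gamma> = coeff B \<gamma> + (\<Sum>\<alpha>\<in>S. coeff V \<alpha> * coeff (D \<alpha>) \<gamma>))"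
    unfolding coeffwise_affine_def by blast
  then show ?thesis unfolding coeffwise_affine_def
    by (intro exI[of _ "B - p"] exI[of _ D]) (simp add: lookup_minus)
qed

text \<open>Pulls the factor \<open>s\<close>, later a coefficient of \<open>V\<close>, out of a
  product with a component of \<open>f\<close>. Scaling is multiplication by the constant polynomial
  \<open>monomial 0 s\<close>, so associativity does the work.\<close>

lemma coeff_monomial_mult_scale:
  fixes g :: "'n::finite mpoly"
  shows "coeff (monomial e (r * s) * g) \<gamma> = s * coeff (monomial e r * g) \<gamma>"
proof -
  have "monomial e (r * s) * g = monomial 0 s * (monomial e r * g)"
    by (simp only: mult.assoc[symmetric] mult_single add_0 mult.commute[of r s])
  also have "\<dots> = Poly_Mapping.map ((*) s) (monomial e r * g)"
    by (simp add: mult_map_scale_conv_mult)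
  finally show ?thesis by (simp add: Poly_Mapping.map.rep_eq when_def)
qed

text \<open>The range \<open>supp V\<close> varies with \<open>V\<close>; over the fixed set
  \<open>S\<close> the sum is visibly linear in the coefficients.\<close>

lemma partial_deriv_superset:
  assumes "finite S" "supp V \<subseteq> S"
  shows "partial_deriv i V = (\<Sum>\<alpha>\<in>S. monomial (\<alpha> - axis i 1) (real (\<alpha> $ i) * coeff V \<alpha>))"
  unfolding partial_deriv_def
proof (rule sum.mono_neutral_left[OF assms], rule ballI)
  fix \<alpha> assume "\<alpha> \<in> S - supp V"
  then have "coeff V \<alpha> = 0" by (simp add: in_keys_iff)
  then show "monomial (\<alpha> - axis i 1) (real (\<alpha> $ i) * coeff V \<alpha>) = 0" by simp
qed

text \<open>Differentiation and multiplication by the fixed \<open>f\<close> are linear, so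
  \<open>B\<close> is 0 and \<open>D \<alpha>\<close> is the orbital derivative of the monomial with
  exponent \<open>\<alpha>\<close>.\<close>

lemma coeffwise_affine_orbital_deriv:
  assumes "finite S"
  shows "coeffwise_affine S (orbital_deriv f)"
proof -
  let ?D = "\<lambda>\<alpha>. \<Sum>i\<in>UNIV. monomial (\<alpha> - axis i 1) (real (\<alpha> $ i)) * f $ i"
  have "coeff (orbital_deriv f V) \<gamma> = (\<Sum>\<alpha>\<in>S. coeff V \<alpha> * coeff (?D \<alpha>) \<gamma>)" if "supp V \<subseteq> S" for V \<gamma>
  proof -
    have "coeff (orbital_deriv f V) \<gamma> =
        (\<Sum>i\<in>UNIV. \<Sum>\<alpha>\<in>S. coeff (monomial (\<alpha> - axis i 1) (real (\<alpha> $ i) * coeff V \<alpha>) * f $ i) \<gamma>)"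
      unfolding orbital_deriv_def partial_deriv_superset[OF assms that]
      by (simp add: sum_distrib_right lookup_sum)
    also have "\<dots> = (\<Sum>\<alpha>\<in>S. \<Sum>i\<in>UNIV. coeff V \<alpha> * coeff (monomial (\<alpha> - axis i 1) (real (\<alpha> $ i)) * f $ i) \<gamma>)"
      unfolding coeff_monomial_mult_scale by (rule sum.swap)
    finally show ?thesis by (simp add: lookup_sum sum_distrib_left)
  qed
  then show ?thesis unfolding coeffwise_affine_def
    by (intro exI[of _ 0] exI[of _ ?D]) simp
qed

lemma mpoly_eval_zero: "mpoly_eval V 0 = coeff V 0"
proof -
  \<comment> \<open>Since \<open>0 ^ 0 = 1\<close>, exactly the constant monomial survives
    evaluation at the origin.\<close>
  have "(\<Prod>i\<in>UNIV. (0 :: real ^ 'n) $ i ^ (\<alpha> $ i)) = (if \<alpha> = 0 then 1 else 0)" for \<alpha> :: "nat ^ 'n"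
    by (auto simp: vec_eq_iff)
  then have "mpoly_eval V 0 = (\<Sum>\<alpha>\<in>supp V. if \<alpha> = 0 then coeff V \<alpha> else 0)"
    unfolding mpoly_eval_def by (intro sum.cong) (auto simp: vec_eq_iff)
  also have "\<dots> = coeff V 0" by (simp add: in_keys_iff)
  finally show ?thesis .
qed

section \<open>The program\<close>

text \<open>\<open>Coeff\<close> holds the coefficients of \<open>V\<close>; \<open>Summand\<close>,
  \<open>Bound\<close> and \<open>Shift\<close> hold \<open>c\<close>, \<open>y\<close> and
  \<open>\<tau>\<close> of \<open>dsonc_system\<close>, with a separate copy for each membership
  condition \<open>k\<close>.\<close>

datatype ('k, 'e, 'n) variable =
  Coeff 'e | Summand 'k 'e 'e | Bound 'k 'e | Shift 'k 'e 'n

lemma affine_form_when: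
  assumes "affine_form I g"
  shows "affine_form I (\<lambda>x. g x when P)"
proof (cases P)
  case True
  with assms show ?thesis by simp
next
  case False
  then show ?thesis using affine_form_const[of I 0] by simp
qed

lemma entropic_dsonc_system:
  assumes "finite I" "finite Ap" "finite Am" "finite T"
    and "\<And>\<gamma>. \<gamma> \<in> T \<Longrightarrow> affine_form I (\<lambda>x. w x \<gamma>)"
    and "\<And>\<beta> \<alpha>. \<beta> \<in> Am \<Longrightarrow> \<alpha> \<in> Ap \<union> Am \<Longrightarrow> Summand k \<beta> \<alpha> \<in> I"
    and "\<And>\<beta>. \<beta> \<in> Am \<Longrightarrow> Bound k \<beta> \<in> I"
    and "\<And>\<beta> i. \<beta> \<in> Am \<Longrightarrow> Shift k \<beta> i \<in> I"
  shows "entropic I (\<lambda>x. dsonc_system Ap Am T (w x)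
    (\<lambda>\<beta> \<alpha>. x (Summand k \<beta> \<alpha>)) (\<lambda>\<beta>. x (Bound k \<beta>)) (\<lambda>\<beta> i. x (Shift k \<beta> i)))"
proof -
  note affine_intros = affine_form_add affine_form_uminus affine_form_scale affine_form_sum affine_form_when
    affine_form_var[OF assms(1)]
  have bound: "entropic I (\<lambda>x. x (Summand k \<beta> \<beta>) \<le> x (Bound k \<beta>))"
      "entropic I (\<lambda>x. - x (Summand k \<beta> \<beta>) \<le> x (Bound k \<beta>))" if "\<beta> \<in> Am" for \<beta>
    using that assms by (intro entropic_le affine_intros; simp)+
  have entropy: "entropic I (\<lambda>x. 0 \<le> x (Bound k \<beta>) \<and> 0 \<le> x (Summand k \<beta> \<alpha>) \<and>
      rel_entropy (x (Bound k \<beta>)) (x (Summand k \<beta> \<alpha>)) \<le>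
      ereal (\<Sum>i\<in>UNIV. (real (\<alpha> $ i) - real (\<beta> $ i)) * x (Shift k \<beta> i)))"
    if "\<beta> \<in> Am" "\<alpha> \<in> Ap" for \<alpha> \<beta>
    using that assms by (intro entropic_rel_entropy affine_intros; simp)
  have coeffs: "entropic I (\<lambda>x. w x \<gamma> =
      (\<Sum>\<beta>\<in>Am. (\<Sum>\<alpha>\<in>Ap. x (Summand k \<beta> \<alpha>) when \<alpha> = \<gamma>) + (x (Summand k \<beta> \<beta>) when \<beta> = \<gamma>)))"
    if "\<gamma> \<in> T" for \<gamma>
    using that assms by (intro entropic_eq affine_intros; simp)
  note summand = entropic_conj[OF entropic_conj[OF bound] entropic_Ball[OF \<open>finite Ap\<close> entropy]]
  show ?thesis
    unfolding dsonc_system_def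
    by (rule entropic_conj[OF entropic_Ball[OF \<open>finite Am\<close> summand] entropic_Ball[OF \<open>finite T\<close> coeffs]])
qed

text \<open>The membership conditions share only the coefficients of \<open>V\<close>. Once
  \<open>V\<close> is fixed, their systems have disjoint auxiliary unknowns, so separate solutions
  combine into one assignment.\<close>

lemma stated_as_rep_dsonc:
  fixes W :: "'k \<Rightarrow> 'n::finite mpoly \<Rightarrow> 'n mpoly"
  assumes fin: "finite S" "finite Ap" "finite Am" "finite K"
    and W: "\<And>k. k \<in> K \<Longrightarrow> coeffwise_affine S (W k)"
  shows "stated_as_rep S (\<lambda>V. supp V \<subseteq> S \<and> coeff V 0 = 0 \<and> (\<forall>k\<in>K. W k V \<in> dsonc Ap Am))"
proof -
  from W have "\<forall>k\<in>K. \<exists>B D. \<forall>V. supp V \<subseteq> S \<longrightarrow>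
      (\<forall>\<gamma>. coeff (W k V) \<gamma> = coeff B \<gamma> + (\<Sum>\<alpha>\<in>S. coeff V \<alpha> * coeff (D \<alpha>) \<gamma>))"
    unfolding coeffwise_affine_def by blast
  from bchoice[OF this] obtain B where "\<forall>k\<in>K. \<exists>D. \<forall>V. supp V \<subseteq> S \<longrightarrow>
      (\<forall>\<gamma>. coeff (W k V) \<gamma> = coeff (B k) \<gamma> + (\<Sum>\<alpha>\<in>S. coeff V \<alpha> * coeff (D \<alpha>) \<gamma>))"
    by blast
  from bchoice[OF this] obtain D where BD: "\<And>k V \<gamma>. k \<in> K \<Longrightarrow> supp V \<subseteq> S \<Longrightarrow>
      coeff (W k V) \<gamma> = coeff (B k) \<gamma> + (\<Sum>\<alpha>\<in>S. coeff V \<alpha> * coeff (D k \<alpha>) \<gamma>)"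
    by blast
  \<comment> \<open>A finite set, independent of \<open>V\<close>, outside which the coefficient
    equations hold trivially.\<close>
  define T where "T k = Ap \<union> Am \<union> supp (B k) \<union> (\<Union>\<alpha>\<in>S. supp (D k \<alpha>))" for k
  have T: "finite (T k)" for k using fin by (simp add: T_def)
  have supp_W: "supp (W k V) \<subseteq> T k" if "k \<in> K" "supp V \<subseteq> S" for k V
  proof
    fix \<gamma> assume "\<gamma> \<in> supp (W k V)"
    then have "coeff (B k) \<gamma> + (\<Sum>\<alpha>\<in>S. coeff V \<alpha> * coeff (D k \<alpha>) \<gamma>) \<noteq> 0"
      using BD[OF that] by (simp add: in_keys_iff)
    then have "coeff (B k) \<gamma> \<noteq> 0 \<or> (\<exists>\<alpha>\<in>S. coeff (D k \<alpha>) \<gamma> \<noteq> 0)"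
      by (metis (no_types, lifting) add.right_neutral mult_zero_right sum.neutral)
    then show "\<gamma> \<in> T k" by (auto simp: T_def in_keys_iff)
  qed
  define I where "I = Coeff ` S \<union> (\<lambda>(k, \<beta>, \<alpha>). Summand k \<beta> \<alpha>) ` (K \<times> Am \<times> (Ap \<union> Am)) \<union>
    (\<lambda>(k, \<beta>). Bound k \<beta>) ` (K \<times> Am) \<union> (\<lambda>(k, \<beta>, i). Shift k \<beta> i) ` (K \<times> Am \<times> (UNIV :: 'n set))"
  have fin_I: "finite I" unfolding I_def using fin by simp
  define w where "w k x \<gamma> = coeff (B k) \<gamma> + (\<Sum>\<alpha>\<in>S. coeff (D k \<alpha>) \<gamma> * x (Coeff \<alpha>))"
    for k \<gamma> and x :: "('k, nat ^ 'n, 'n) variable \<Rightarrow> real"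
  define R where "R k x \<longleftrightarrow> dsonc_system Ap Am (T k) (w k x)
    (\<lambda>\<beta> \<alpha>. x (Summand k \<beta> \<alpha>)) (\<lambda>\<beta>. x (Bound k \<beta>)) (\<lambda>\<beta> i. x (Shift k \<beta> i))" for k x
  \<comment> \<open>The constant coefficient is an unknown only if 0 lies in \<open>S\<close>;
    otherwise it vanishes because \<open>supp V \<subseteq> S\<close>.\<close>
  define Q where "Q x \<longleftrightarrow> (\<forall>\<alpha>\<in>S \<inter> {0}. x (Coeff \<alpha>) = 0) \<and> (\<forall>k\<in>K. R k x)" for x
  have "entropic I (R k)" if "k \<in> K" for k
    unfolding R_def
  proof (rule entropic_dsonc_system)
    show "affine_form I (\<lambda>x. w k x \<gamma>)" for \<gamma>
      unfolding w_def using fin_I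
      by (intro affine_form_add affine_form_const affine_form_sum affine_form_scale affine_form_var)
        (auto simp: I_def)
    show "Summand k \<beta> \<alpha> \<in> I" if "\<beta> \<in> Am" "\<alpha> \<in> Ap \<union> Am" for \<beta> \<alpha>
      unfolding I_def using \<open>k \<in> K\<close> that by (force simp: image_iff)
    show "Bound k \<beta> \<in> I" if "\<beta> \<in> Am" for \<beta>
      unfolding I_def using \<open>k \<in> K\<close> that by (force simp: image_iff)
    show "Shift k \<beta> i \<in> I" if "\<beta> \<in> Am" for \<beta> i
      unfolding I_def using \<open>k \<in> K\<close> that by (force simp: image_iff)
  qed (fact fin_I fin T)+
  then have "entropic I Q"
    unfolding Q_def using fin fin_I
    by (intro entropic_conj entropic_Ball entropic_eq affine_form_const affine_form_var) (auto simp: I_def)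
  then obtain P L where P: "is_rep P" "\<forall>\<alpha>\<in>S. linear_function (rep_size P) (L \<alpha>)"
    "\<And>v. (\<exists>x. Q x \<and> (\<forall>\<alpha>\<in>S. x (Coeff \<alpha>) = v \<alpha>)) \<longleftrightarrow> (\<exists>p\<in>rep_feasible P. \<forall>\<alpha>\<in>S. L \<alpha> p = v \<alpha>)"
    using entropic_projection[OF fin_I, of Q Coeff S] I_def by blast
  have "coeff V 0 = 0 \<and> (\<forall>k\<in>K. W k V \<in> dsonc Ap Am) \<longleftrightarrow> (\<exists>x. Q x \<and> (\<forall>\<alpha>\<in>S. x (Coeff \<alpha>) = coeff V \<alpha>))"
    (is "?l \<longleftrightarrow> ?r") if V: "supp V \<subseteq> S" for V
  proof -
    have zero: "coeff V 0 = 0 \<longleftrightarrow> (\<forall>\<alpha>\<in>S \<inter> {0}. coeff V \<alpha> = 0)"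
      using V by (auto simp: in_keys_iff)
    have wW: "w k x = coeff (W k V)" if "k \<in> K" "\<forall>\<alpha>\<in>S. x (Coeff \<alpha>) = coeff V \<alpha>" for k x
      using that BD[OF that(1) V] by (auto simp: w_def fun_eq_iff mult.commute intro!: sum.cong)
    have system: "W k V \<in> dsonc Ap Am \<longleftrightarrow> (\<exists>c y \<tau>. dsonc_system Ap Am (T k) (coeff (W k V)) c y \<tau>)"
      if "k \<in> K" for k
      by (rule dsonc_iff_system) (use fin supp_W[OF that V] in \<open>auto simp: T_def\<close>)
    show ?thesis
    proof
      assume l: ?l
      then obtain c y \<tau> where *:
        "\<And>k. k \<in> K \<Longrightarrow> dsonc_system Ap Am (T k) (coeff (W k V)) (c k) (y k) (\<tau> k)"
        using system by metis
      define x where "x = case_variable (coeff V) c y \<tau>"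
      have x: "\<forall>\<alpha>\<in>S. x (Coeff \<alpha>) = coeff V \<alpha>" by (simp add: x_def)
      have "R k x" if "k \<in> K" for k
        unfolding R_def wW[OF that x] using *[OF that] by (simp add: x_def)
      moreover have "\<forall>\<alpha>\<in>S \<inter> {0}. x (Coeff \<alpha>) = 0" using l by (simp add: x_def)
      ultimately have "Q x" unfolding Q_def by blast
      with x show ?r by blast
    next
      assume ?r
      then obtain x where x: "Q x" "\<forall>\<alpha>\<in>S. x (Coeff \<alpha>) = coeff V \<alpha>" by blast
      have "W k V \<in> dsonc Ap Am" if "k \<in> K" for k
      proof -
        from x(1) that have "R k x" by (simp add: Q_def)
        then show ?thesis unfolding system[OF that] R_def wW[OF that x(2)] by blast
      qed
      moreover have "coeff V 0 = 0" unfolding zero using x by (auto simp: Q_def)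
      ultimately show ?l by blast
    qed
  qed
  with P show ?thesis unfolding stated_as_rep_def coeffs_extend_to_feasible_def
    by (intro exI[of _ P] exI[of _ L]) blast
qed

theorem proposition3p10:
  fixes f :: "'n::finite mpoly ^ 'n"
    and p1 p2 :: "'n mpoly"
    and A Ap Am :: "(nat ^ 'n) set"
  assumes f_zero: "\<And>i. mpoly_eval (f $ i) 0 = 0"
    and p1_pos: "\<And>x. x \<noteq> 0 \<Longrightarrow> mpoly_eval p1 x > 0"
    and p2_pos: "\<And>x. x \<noteq> 0 \<Longrightarrow> mpoly_eval p2 x > 0"
    and A_finite: "finite A"
    and A_union: "A = Ap \<union> Am"
    and A_disjoint: "Ap \<inter> Am = {}"
    and Ap_even: "\<And>\<alpha> i. \<alpha> \<in> Ap \<Longrightarrow> even (\<alpha> $ i)"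
  shows "stated_as_rep (A \<union> supp p1)
           (\<lambda>V. mpoly_eval V 0 = 0 \<and> V - p1 \<in> dsonc Ap Am \<and>
                - orbital_deriv f V \<in> dsonc Ap Am)
       \<and> stated_as_rep (A \<union> supp p1)
           (\<lambda>V. mpoly_eval V 0 = 0 \<and> V - p1 \<in> dsonc Ap Am \<and>
                - orbital_deriv f V \<in> dsonc Ap Am \<and>
                - orbital_deriv f V - p2 \<in> dsonc Ap Am)"
proof -
  let ?S = "A \<union> supp p1"
  \<comment> \<open>The maps serve as their own indices: \<open>stated_as_rep_dsonc\<close> is
    applied with the identity as its family \<open>W\<close>.\<close>
  let ?Ws = "{\<lambda>V. V - p1, \<lambda>V. - orbital_deriv f V}"
  let ?Ws' = "insert (\<lambda>V. - orbital_deriv f V - p2) ?Ws"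
  have fin: "finite ?S" "finite Ap" "finite Am" using A_finite A_union by auto
  have affine: "coeffwise_affine ?S W" if "W \<in> ?Ws'" for W
    using that fin(1)
    by (auto intro!: coeffwise_affine_diff_const coeffwise_affine_uminus coeffwise_affine_id
        coeffwise_affine_orbital_deriv)
  \<comment> \<open>Membership of \<open>V - p1\<close> in the cone already implies the support
    condition, so the extra conjunct of \<open>stated_as_rep_dsonc\<close> changes nothing.\<close>
  have supp: "supp V \<subseteq> ?S" if "V - p1 \<in> dsonc Ap Am" for V
  proof -
    have "supp (V - p1) \<subseteq> A" using supp_dsonc[OF fin(3) that] A_union by simp
    moreover have "supp V \<subseteq> supp (V - p1) \<union> supp p1" using keys_add[of "V - p1" p1] by simp
    ultimately show ?thesis by blast
  qed
  have "stated_as_rep ?S (\<lambda>V. supp V \<subseteq> ?S \<and> coeff V 0 = 0 \<and> (\<forall>W\<in>?Ws. W V \<in> dsonc Ap Am))"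
    using affine by (intro stated_as_rep_dsonc fin) auto
  moreover have "stated_as_rep ?S (\<lambda>V. supp V \<subseteq> ?S \<and> coeff V 0 = 0 \<and> (\<forall>W\<in>?Ws'. W V \<in> dsonc Ap Am))"
    using affine by (intro stated_as_rep_dsonc fin) auto
  moreover have "(\<lambda>V. supp V \<subseteq> ?S \<and> coeff V 0 = 0 \<and> (\<forall>W\<in>?Ws. W V \<in> dsonc Ap Am)) =
      (\<lambda>V. mpoly_eval V 0 = 0 \<and> V - p1 \<in> dsonc Ap Am \<and> - orbital_deriv f V \<in> dsonc Ap Am)"
    using supp by (auto simp: fun_eq_iff mpoly_eval_zero)
  moreover have "(\<lambda>V. supp V \<subseteq> ?S \<and> coeff V 0 = 0 \<and> (\<forall>W\<in>?Ws'. W V \<in> dsonc Ap Am)) =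
      (\<lambda>V. mpoly_eval V 0 = 0 \<and> V - p1 \<in> dsonc Ap Am \<and> - orbital_deriv f V \<in> dsonc Ap Am \<and>
        - orbital_deriv f V - p2 \<in> dsonc Ap Am)"
    using supp by (auto simp: fun_eq_iff mpoly_eval_zero)
  ultimately show ?thesis by simp
qed

end
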